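(* For all $a,b,c,x,z,\alpha\in\mathbb{C}$ and $m\in\mathbb{Z}^{+}$, $$\Bigl(\frac{1}{1-x}\Bigr)^{-m}(1-x)^{\alpha+1}\;{}_1F_2\Bigl(a;b,c;\frac{1}{xz+1}\Bigr)=\sum_{n=0}^{\infty}\sum_{j=0}^{\infty}\frac{\Gamma(b)\,\Gamma(c)\,(-1)^{2m+n}\bigl(\frac{1}{1-x}\bigr)^n x^n\,\Gamma(a+j)\,\Gamma(m+n+\alpha+1)\;{}_2F_1(j,-n;\,m+\alpha+1;\,-z)}{\Gamma(a)\,\Gamma(j+1)\,\Gamma(n+1)\,\Gamma(b+j)\,\Gamma(c+j)\,\Gamma(m+\alpha+1)}.$$
   Context: $\Gamma$ is the Euler gamma function; with $(a)_k=a(a+1)\cdots(a+k-1)$, ${}_2F_1(a,b;c;z)=\sum_{k\ge0}\frac{(a)_k(b)_k}{(c)_k\,k!}z^k$ is the Gauss hypergeometric function and ${}_1F_2(a;b,c;z)=\sum_{k\ge0}\frac{(a)_k}{(b)_k(c)_k\,k!}z^k$ is the generalized hypergeometric function. $\mathbb{Z}^{+}$ is the set of positive integers.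
   Formalization: Instead of all complex values: a, b, c, m+α+1 are not nonpositive integers, x≠1, xz≠−1, and equality is claimed where the outer series over n converges (proved if |x|<|1−x| and |x(1+z)|<|1−x|); e.g. at x=2, z=1 it generally diverges. *)

theory Defs
  imports "HOL-Analysis.Analysis"
begin

(* If a numerator parameter is a nonpositive integer, the series terminates, so that the value
   below is meaningful for every z, also outside the unit disc. *)
definition hyp2F1 :: "complex \<Rightarrow> complex \<Rightarrow> complex \<Rightarrow> complex \<Rightarrow> complex" where
  "hyp2F1 a b c z =
     (\<Sum>k. pochhammer a k * pochhammer b k / (pochhammer c k * fact k) * z ^ k)"

definition hyp1F2 :: "complex \<Rightarrow> complex \<Rightarrow> complex \<Rightarrow> complex \<Rightarrow> complex" where
  "hyp1F2 a b c z =
     (\<Sum>k. pochhammer a k / (pochhammer b k * pochhammer c k * fact k) * z ^ k)"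

end

theory Submission
  imports Defs "HOL-Complex_Analysis.Complex_Analysis"
begin

text \<open>With $u = -x/(1-x)$ and $\beta = m + \alpha + 1$, the inner sums are the terms $g_n u^n$ of the
  Taylor series at $0$ of
  $F(t) = (1-t)^{-\beta}\, {}_1F_2(a; b, c; (1-t)/(1-(1+z)t))$, and the left-hand side is $F(u)$.
  Comparing Taylor coefficients termwise reduces this to the classical generating function of
  the polynomials ${}_2F_1(j, -n; \beta; -z)$.
  The only singularities of $F$ are $t = 1$ and $t = 1/(1+z)$; neither is removable unless
  $F = 0$, so convergence at $u$ forces $u$ into the closed disc of holomorphy.
  As $u$ is itself not a singularity, Abel's limit theorem settles the boundary case.\<close>

subsection \<open>Abel's limit theorem\<close>

lemma Abel_limit:
  fixes f :: "nat \<Rightarrow> complex"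
  assumes "summable f"
  shows "((\<lambda>r. \<Sum>n. f n * of_real r ^ n) \<longlongrightarrow> suminf f) (at_left (1::real))"
proof (rule tendstoI)
  fix e :: real assume e: "e > 0"
  define b where "b n = (\<Sum>k\<le>n. f k) - suminf f" for n
  have b0: "b \<longlonglongrightarrow> 0"
    unfolding b_def using summable_LIMSEQ'[OF assms] by (simp add: LIM_zero)
  then obtain N where N: "\<And>n. n \<ge> N \<Longrightarrow> norm (b n) < e / 2"
    using LIMSEQ_D[OF b0, of "e / 2"] e by auto
  obtain B where B: "B > 0" "\<And>n. norm (b n) \<le> B"
    using BseqE[OF convergent_imp_Bseq[OF convergentI[OF b0]]] by metis
  have id: "(\<Sum>n. f n * of_real r ^ n) - suminf f = (1 - of_real r) * (\<Sum>n. b n * of_real r ^ n)"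
    and sm: "summable (\<lambda>n. norm (b n) * r ^ n)"
    if r: "0 < r" "r < 1" for r :: real
  proof -
    show sm: "summable (\<lambda>n. norm (b n) * r ^ n)"
      by (rule summable_comparison_test'[OF summable_mult[OF summable_geometric[of r], of B]])
         (use r B in \<open>auto simp: norm_mult norm_power intro!: mult_right_mono\<close>)
    have s1: "summable (\<lambda>n. b n * of_real r ^ n)"
      by (rule summable_norm_cancel) (use r sm in \<open>simp add: norm_mult norm_power\<close>)
    have s2: "(\<lambda>n. suminf f * of_real r ^ n) sums (suminf f * (1 / (1 - of_real r)))"
      by (intro sums_mult geometric_sums) (use r in auto)
    have fb: "f (Suc n) = b (Suc n) - b n" "f 0 = b 0 + suminf f" for n
      by (simp_all add: b_def)
    have "(\<lambda>n. b (Suc n) * of_real r ^ Suc n) sums ((\<Sum>n. b n * of_real r ^ n) - b 0 * of_real r ^ 0)"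
      using s1 by (subst sums_Suc_iff) (simp add: summable_sums)
    moreover have "(\<lambda>n. of_real r * (b n * of_real r ^ n)) sums (of_real r * (\<Sum>n. b n * of_real r ^ n))"
      using s1 by (intro sums_mult summable_sums)
    ultimately have "(\<lambda>n. f (Suc n) * of_real r ^ Suc n) sums
        ((\<Sum>n. b n * of_real r ^ n) - b 0 * of_real r ^ 0 - of_real r * (\<Sum>n. b n * of_real r ^ n))"
      unfolding fb by (drule_tac sums_diff) (auto simp: algebra_simps)
    hence "(\<lambda>n. f n * of_real r ^ n) sums
        ((\<Sum>n. b n * of_real r ^ n) - b 0 * of_real r ^ 0 - of_real r * (\<Sum>n. b n * of_real r ^ n)
           + f 0 * of_real r ^ 0)"
      by (subst (asm) sums_Suc_iff) simp
    thus "(\<Sum>n. f n * of_real r ^ n) - suminf f = (1 - of_real r) * (\<Sum>n. b n * of_real r ^ n)"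
      by (simp add: sums_iff fb algebra_simps)
  qed
  define C where "C = (\<Sum>n<N. B) + 1"
  have C: "C > 0" using B by (simp add: C_def add_nonneg_pos)
  have "eventually (\<lambda>r::real. r \<in> {max 0 (1 - e / (2 * C))<..<1}) (at_left 1)"
    using e C by (intro eventually_at_left_real) auto
  thus "eventually (\<lambda>r. dist (\<Sum>n. f n * of_real r ^ n) (suminf f) < e) (at_left (1::real))"
  proof eventually_elim
    case (elim r)
    hence r: "0 < r" "r < 1" "(1 - r) * C < e / 2" using C
      by (auto simp: field_simps)
    have "norm (\<Sum>n. b n * of_real r ^ n) \<le> (\<Sum>n. norm (b n) * r ^ n)"
      by (rule order_trans[OF summable_norm]) (use sm[OF r(1,2)] r in \<open>auto simp: norm_mult norm_power\<close>)
    also have "\<dots> = (\<Sum>n<N. norm (b n) * r ^ n) + (\<Sum>n. norm (b (n + N)) * r ^ (n + N))"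
      by (subst suminf_split_initial_segment[OF sm[OF r(1,2)], of N]) simp
    also have "(\<Sum>n<N. norm (b n) * r ^ n) \<le> (\<Sum>n<N. B * 1)"
      by (intro sum_mono mult_mono B power_le_one) (use r B in auto)
    also have "(\<Sum>n. norm (b (n + N)) * r ^ (n + N)) \<le> (\<Sum>n. e / 2 * r ^ n)"
    proof (rule suminf_le)
      show "summable (\<lambda>n. norm (b (n + N)) * r ^ (n + N))"
        using summable_ignore_initial_segment[OF sm[OF r(1,2)], of N] by simp
      show "summable (\<lambda>n. e / 2 * r ^ n)" using r by (intro summable_mult summable_geometric) auto
      show "norm (b (n + N)) * r ^ (n + N) \<le> e / 2 * r ^ n" for n
        using N[of "n + N"] r e by (intro mult_mono power_decreasing) auto
    qed
    also have "(\<Sum>n. e / 2 * r ^ n) = e / 2 / (1 - r)"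
      using r by (subst suminf_mult) (auto simp: suminf_geometric)
    finally have "norm (\<Sum>n. b n * of_real r ^ n) \<le> C - 1 + e / 2 / (1 - r)"
      by (simp add: C_def)
    hence "(1 - r) * norm (\<Sum>n. b n * of_real r ^ n) \<le> (1 - r) * (C - 1 + e / 2 / (1 - r))"
      using r by (intro mult_left_mono) auto
    also have "\<dots> = (1 - r) * C - (1 - r) + e / 2" using r by (simp add: field_simps)
    also have "\<dots> < e" using r by linarith
    also have "(1 - r) = norm (1 - complex_of_real r)"
      using r by (metis abs_of_pos diff_gt_0_iff_gt norm_of_real of_real_1 of_real_diff)
    finally show ?case by (simp add: dist_norm id[OF r(1,2)] norm_mult)
  qed
qed

subsection \<open>Non-extendability of complex powers\<close>

lemma one_minus_not_nonpos_Reals: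
  fixes t :: complex
  assumes "norm t \<le> 1" "t \<noteq> 1"
  shows "1 - t \<notin> \<real>\<^sub>\<le>\<^sub>0"
proof
  assume "1 - t \<in> \<real>\<^sub>\<le>\<^sub>0"
  hence "Re t \<ge> 1" "Im t = 0" by (auto simp: complex_nonpos_Reals_iff)
  moreover have "Re t \<le> 1" using complex_Re_le_cmod[of t] assms by linarith
  ultimately show False using assms(2) by (simp add: complex_eq_iff)
qed

lemma not_nonpos_Ints_plus_of_nat:
  fixes b :: complex
  assumes "b \<notin> \<int>\<^sub>\<le>\<^sub>0"
  shows "b + of_nat n \<noteq> 0"
  using assms plus_of_nat_eq_0_imp by blast

text \<open>A holomorphic extension \<^term>\<open>h\<close> satisfies $(1-t)h' = \beta h$; differentiating this $n$ times at $t = 1$ gives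
  $(\beta+n) h^{(n)}(1) = 0$, so \<^term>\<open>h\<close> would vanish unless some $\beta + n = 0$.\<close>

lemma powr_extends_imp_nonpos_Ints:
  fixes h :: "complex \<Rightarrow> complex"
  assumes d: "d > 0" and h: "h holomorphic_on ball 1 d"
    and eq: "\<And>t. t \<in> ball 1 d \<Longrightarrow> norm t < 1 \<Longrightarrow> h t = (1 - t) powr (- \<beta>)"
  shows "\<beta> \<in> \<int>\<^sub>\<le>\<^sub>0"
proof (rule ccontr)
  assume \<beta>: "\<beta> \<notin> \<int>\<^sub>\<le>\<^sub>0"
  define D where "D = ball (1::complex) d"
  have D: "open D" "connected D" "1 \<in> D" using d by (auto simp: D_def)
  have hd: "(deriv ^^ n) h holomorphic_on D" for n
    using h by (intro holomorphic_higher_deriv) (auto simp: D_def)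
  define U where "U = D \<inter> ball 0 1"
  have U: "open U" "U \<subseteq> D" using D by (auto simp: U_def)
  define p where "p = complex_of_real (1 - min d 1 / 2)"
  have p: "p \<in> U"
  proof -
    have "1 - p = of_real (min d 1 / 2)" by (simp add: p_def)
    hence "norm (1 - p) = min d 1 / 2" using d by (simp only: norm_of_real)
    moreover have "norm p = 1 - min d 1 / 2" using d unfolding p_def norm_of_real by auto
    ultimately show ?thesis using d by (auto simp: U_def D_def dist_norm)
  qed
  have ode0: "(1 - t) * deriv h t - \<beta> * h t = 0" if t: "t \<in> D" for t
  proof (rule analytic_continuation[of "\<lambda>t. (1 - t) * deriv h t - \<beta> * h t" D U p])
    show "(\<lambda>t. (1 - t) * deriv h t - \<beta> * h t) holomorphic_on D"
      using hd[of 0] hd[of 1] D by (intro holomorphic_intros) auto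
    show "p islimpt U" using U p interior_limit_point interior_open by blast
    show "p \<in> D" using p U by auto
    show "(1 - t) * deriv h t - \<beta> * h t = 0" if t: "t \<in> U" for t
    proof -
      have t': "norm t < 1" "t \<in> ball 1 d" using t by (auto simp: U_def D_def)
      have "1 - t \<notin> \<real>\<^sub>\<le>\<^sub>0" using t' by (intro one_minus_not_nonpos_Reals) auto
      hence "((\<lambda>t. (1 - t) powr (-\<beta>)) has_field_derivative \<beta> * (1 - t) powr (-\<beta> - 1)) (at t)"
        by (auto intro!: derivative_eq_intros)
      moreover have "eventually (\<lambda>t. h t = (1 - t) powr (-\<beta>)) (nhds t)"
        using eventually_nhds_in_open[OF U(1) t] by eventually_elim (auto simp: U_def D_def intro!: eq)
      ultimately have "(h has_field_derivative \<beta> * (1 - t) powr (-\<beta> - 1)) (at t)"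
        by (subst DERIV_cong_ev[OF refl _ refl]) auto
      hence "deriv h t = \<beta> * (1 - t) powr (-\<beta> - 1)" by (rule DERIV_imp_deriv)
      moreover have "(1 - t) * (1 - t) powr (-\<beta> - 1) = (1 - t) powr (-\<beta>)"
        using t' by (auto simp: powr_diff)
      ultimately show ?thesis using eq[OF t'(2,1)] by simp
    qed
  qed (use D U t in auto)
  have ode: "\<forall>t\<in>D. (1 - t) * (deriv ^^ Suc n) h t = (\<beta> + of_nat n) * (deriv ^^ n) h t" for n
  proof (induction n)
    case 0
    show ?case using ode0 by simp
  next
    case (Suc n)
    show ?case
    proof
      fix t assume t: "t \<in> D"
      have der: "((deriv ^^ k) h has_field_derivative (deriv ^^ Suc k) h t) (at t)" for k
        using holomorphic_derivI[OF hd[of k] D(1) t] by simp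
      have "((\<lambda>t. (1 - t) * (deriv ^^ Suc n) h t) has_field_derivative
          (1 - t) * (deriv ^^ Suc (Suc n)) h t - (deriv ^^ Suc n) h t) (at t)"
        by (rule derivative_eq_intros der refl | simp)+
      moreover have "((\<lambda>t. (\<beta> + of_nat n) * (deriv ^^ n) h t) has_field_derivative
          (\<beta> + of_nat n) * (deriv ^^ Suc n) h t) (at t)"
        by (rule DERIV_cmult der)+
      moreover have "eventually (\<lambda>t. (1 - t) * (deriv ^^ Suc n) h t = (\<beta> + of_nat n) * (deriv ^^ n) h t) (nhds t)"
        using eventually_nhds_in_open[OF D(1) t] by eventually_elim (use Suc in blast)
      hence "deriv (\<lambda>t. (1 - t) * (deriv ^^ Suc n) h t) t = deriv (\<lambda>t. (\<beta> + of_nat n) * (deriv ^^ n) h t) t"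
        by (intro deriv_cong_ev refl)
      ultimately have "(1 - t) * (deriv ^^ Suc (Suc n)) h t - (deriv ^^ Suc n) h t = (\<beta> + of_nat n) * (deriv ^^ Suc n) h t"
        by (metis DERIV_imp_deriv)
      thus "(1 - t) * (deriv ^^ Suc (Suc n)) h t = (\<beta> + of_nat (Suc n)) * (deriv ^^ Suc n) h t"
        by (simp add: algebra_simps del: funpow.simps)
    qed
  qed
  have "(deriv ^^ n) h 1 = 0" for n
  proof -
    have "(\<beta> + of_nat n) * (deriv ^^ n) h 1 = 0" using ode[of n] D(3) by force
    moreover have "\<beta> + of_nat n \<noteq> 0" using \<beta> by (rule not_nonpos_Ints_plus_of_nat)
    ultimately show ?thesis by simp
  qed
  hence "h p = 0"
    using holomorphic_fun_eq_0_on_ball[OF h, of p] p by (auto simp: U_def D_def)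
  thus False using eq[of p] p by (auto simp: U_def D_def)
qed

subsection \<open>The entire function ${}_1F_2$\<close>

definition coeff1F2 :: "complex \<Rightarrow> complex \<Rightarrow> complex \<Rightarrow> nat \<Rightarrow> complex" where
  "coeff1F2 a b c k = pochhammer a k / (pochhammer b k * pochhammer c k * fact k)"

lemma hyp1F2_conv_coeff1F2: "hyp1F2 a b c z = (\<Sum>k. coeff1F2 a b c k * z ^ k)"
  by (simp add: hyp1F2_def coeff1F2_def)

lemma pochhammer_not_nonpos_Ints:
  fixes b :: complex
  assumes "b \<notin> \<int>\<^sub>\<le>\<^sub>0"
  shows "pochhammer b n \<noteq> 0"
  using assms pochhammer_eq_0_imp_nonpos_Int by blast

lemma conv_radius_coeff1F2:
  assumes "a \<notin> \<int>\<^sub>\<le>\<^sub>0" "b \<notin> \<int>\<^sub>\<le>\<^sub>0" "c \<notin> \<int>\<^sub>\<le>\<^sub>0"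
  shows "conv_radius (coeff1F2 a b c) = \<infinity>"
proof -
  have quot: "(\<lambda>n. (a + of_nat n) / (b + of_nat n)) \<longlonglongrightarrow> 1"
  proof -
    have z: "(\<lambda>n. s / of_nat n) \<longlonglongrightarrow> 0" for s :: complex
      by (rule lim_const_over_n)
    have "(\<lambda>n. (a / of_nat n + 1) / (b / of_nat n + 1)) \<longlonglongrightarrow> (0 + 1) / (0 + 1)"
      by (intro tendsto_intros z) auto
    moreover have "eventually (\<lambda>n. (a / of_nat n + 1) / (b / of_nat n + 1) = (a + of_nat n) / (b + of_nat n)) sequentially"
      using eventually_gt_at_top[of 0]
    proof eventually_elim
      case (elim n)
      have "(a + of_nat n) / (b + of_nat n) = ((a + of_nat n) / of_nat n) / ((b + of_nat n) / of_nat n)"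
        using elim by simp
      thus ?case using elim by (simp add: add_divide_distrib)
    qed
    ultimately show ?thesis by (simp add: tendsto_cong)
  qed
  have inv: "(\<lambda>n. 1 / (s + of_nat n)) \<longlonglongrightarrow> 0" for s :: complex
    by (intro tendsto_divide_0[OF tendsto_const] tendsto_add_filterlim_at_infinity[OF tendsto_const] tendsto_of_nat)
  have "(\<lambda>n. (a + of_nat n) / (b + of_nat n) * (1 / (c + of_nat n)) * (1 / (1 + of_nat n))) \<longlonglongrightarrow> 1 * 0 * 0"
    by (intro tendsto_mult quot inv)
  moreover have "coeff1F2 a b c (Suc n) / coeff1F2 a b c n =
      (a + of_nat n) / (b + of_nat n) * (1 / (c + of_nat n)) * (1 / (1 + of_nat n))" for n
    using pochhammer_not_nonpos_Ints[OF assms(1), of n] pochhammer_not_nonpos_Ints[OF assms(2), of n]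
      pochhammer_not_nonpos_Ints[OF assms(3), of n]
      not_nonpos_Ints_plus_of_nat[OF assms(2), of n] not_nonpos_Ints_plus_of_nat[OF assms(3), of n]
    by (simp add: coeff1F2_def pochhammer_Suc fact_Suc divide_simps)
  ultimately have "(\<lambda>n. norm (coeff1F2 a b c (Suc n) / coeff1F2 a b c n)) \<longlonglongrightarrow> 0"
    by (simp add: tendsto_norm_zero)
  moreover have nz: "coeff1F2 a b c n \<noteq> 0" for n
    using pochhammer_not_nonpos_Ints[OF assms(1)] pochhammer_not_nonpos_Ints[OF assms(2)]
      pochhammer_not_nonpos_Ints[OF assms(3)] by (simp add: coeff1F2_def)
  ultimately have "filterlim (\<lambda>n. inverse (norm (coeff1F2 a b c (Suc n) / coeff1F2 a b c n))) at_top sequentially"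
    by (intro filterlim_inverse_at_top) auto
  hence "filterlim (\<lambda>n. norm (coeff1F2 a b c n) / norm (coeff1F2 a b c (Suc n))) at_top sequentially"
    by (simp add: norm_divide)
  thus ?thesis
    by (intro conv_radius_ratio_limit_ereal always_eventually allI nz) (simp add: tendsto_PInfty_eq_at_top)
qed

lemma hyp1F2_sums:
  assumes "a \<notin> \<int>\<^sub>\<le>\<^sub>0" "b \<notin> \<int>\<^sub>\<le>\<^sub>0" "c \<notin> \<int>\<^sub>\<le>\<^sub>0"
  shows "(\<lambda>k. coeff1F2 a b c k * z ^ k) sums hyp1F2 a b c z"
    and "summable (\<lambda>k. norm (coeff1F2 a b c k * z ^ k))"
proof -
  have z: "ereal (norm z) < conv_radius (coeff1F2 a b c)"
    by (simp add: conv_radius_coeff1F2[OF assms])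
  show "(\<lambda>k. coeff1F2 a b c k * z ^ k) sums hyp1F2 a b c z"
    unfolding hyp1F2_conv_coeff1F2 by (intro summable_sums summable_in_conv_radius z)
  show "summable (\<lambda>k. norm (coeff1F2 a b c k * z ^ k))"
    by (intro abs_summable_in_conv_radius z)
qed

lemma hyp1F2_has_fps_expansion:
  assumes "a \<notin> \<int>\<^sub>\<le>\<^sub>0" "b \<notin> \<int>\<^sub>\<le>\<^sub>0" "c \<notin> \<int>\<^sub>\<le>\<^sub>0"
  shows "hyp1F2 a b c has_fps_expansion Abs_fps (coeff1F2 a b c)"
  using hyp1F2_sums(1)[OF assms] by (intro has_fps_expansionI always_eventually) simp

lemma holomorphic_hyp1F2:
  assumes "a \<notin> \<int>\<^sub>\<le>\<^sub>0" "b \<notin> \<int>\<^sub>\<le>\<^sub>0" "c \<notin> \<int>\<^sub>\<le>\<^sub>0"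
  shows "hyp1F2 a b c holomorphic_on A"
proof -
  have "eval_fps (Abs_fps (coeff1F2 a b c)) holomorphic_on A"
    by (intro holomorphic_on_eval_fps) (simp add: fps_conv_radius_def conv_radius_coeff1F2[OF assms])
  also have "eval_fps (Abs_fps (coeff1F2 a b c)) = hyp1F2 a b c"
    by (simp add: fun_eq_iff eval_fps_def hyp1F2_conv_coeff1F2)
  finally show ?thesis .
qed

lemma holomorphic_on_hyp1F2 [holomorphic_intros]:
  assumes "a \<notin> \<int>\<^sub>\<le>\<^sub>0" "b \<notin> \<int>\<^sub>\<le>\<^sub>0" "c \<notin> \<int>\<^sub>\<le>\<^sub>0" "f holomorphic_on A"
  shows "(\<lambda>t. hyp1F2 a b c (f t)) holomorphic_on A"
  using holomorphic_on_compose[OF assms(4) holomorphic_hyp1F2[OF assms(1-3)]] by (simp add: o_def)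

lemma hyp1F2_0:
  assumes "a \<notin> \<int>\<^sub>\<le>\<^sub>0" "b \<notin> \<int>\<^sub>\<le>\<^sub>0" "c \<notin> \<int>\<^sub>\<le>\<^sub>0"
  shows "hyp1F2 a b c 0 = 1"
  using sums_unique2[OF hyp1F2_sums(1)[OF assms, of 0] powser_sums_zero] by (simp add: coeff1F2_def)

lemma hyp1F2_not_convergent_at_infinity:
  assumes "a \<notin> \<int>\<^sub>\<le>\<^sub>0" "b \<notin> \<int>\<^sub>\<le>\<^sub>0" "c \<notin> \<int>\<^sub>\<le>\<^sub>0"
  shows "\<not> (hyp1F2 a b c \<longlongrightarrow> l) at_infinity"
proof
  assume "(hyp1F2 a b c \<longlongrightarrow> l) at_infinity"
  hence "hyp1F2 a b c z = l" for z
    by (rule Liouville_weak[OF holomorphic_hyp1F2[OF assms]])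
  hence "hyp1F2 a b c = (\<lambda>_. l)" by (simp add: fun_eq_iff)
  hence "Abs_fps (coeff1F2 a b c) = fps_const l"
    using hyp1F2_has_fps_expansion[OF assms] by (metis fps_expansion_unique_complex has_fps_expansion_const)
  hence "fps_nth (Abs_fps (coeff1F2 a b c)) 1 = 0" by simp
  moreover have "coeff1F2 a b c 1 \<noteq> 0" using assms by (auto simp: coeff1F2_def)
  ultimately show False by simp
qed

subsection \<open>The generating function of ${}_2F_1(j, -n; \beta; -z)$\<close>

definition binom_coeff :: "complex \<Rightarrow> nat \<Rightarrow> nat \<Rightarrow> complex" where
  "binom_coeff \<beta> k n = (if k \<le> n then pochhammer (\<beta> + of_nat k) (n - k) / fact (n - k) else 0)"

lemma binom_coeff_Suc_Suc_diff:
  "binom_coeff \<beta> (Suc k) (Suc n) - binom_coeff \<beta> (Suc k) n = binom_coeff \<beta> k n"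
proof (cases "k < n")
  case True
  then obtain i where n: "n = Suc (k + i)" using less_iff_Suc_add by auto
  have "pochhammer (\<beta> + of_nat k) (Suc i) = (\<beta> + of_nat k) * pochhammer (\<beta> + of_nat (Suc k)) i"
    by (simp add: pochhammer_rec add_ac)
  moreover have "pochhammer (\<beta> + of_nat (Suc k)) (Suc i) =
      pochhammer (\<beta> + of_nat (Suc k)) i * (\<beta> + of_nat (Suc k) + of_nat i)"
    by (simp add: pochhammer_Suc)
  moreover have "(1 + of_nat i :: complex) \<noteq> 0"
    by (metis of_nat_Suc of_nat_neq_0)
  ultimately show ?thesis
    unfolding n binom_coeff_def by (simp add: fact_Suc divide_simps del: of_nat_Suc) (simp add: algebra_simps)
qed (auto simp: binom_coeff_def)

definition kernel_coeff :: "complex \<Rightarrow> complex \<Rightarrow> nat \<Rightarrow> nat \<Rightarrow> complex" where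
  "kernel_coeff \<beta> z j n = pochhammer \<beta> n / fact n * hyp2F1 (of_nat j) (- of_nat n) \<beta> (- z)"

lemma kernel_coeff_altdef:
  assumes "\<beta> \<notin> \<int>\<^sub>\<le>\<^sub>0"
  shows "kernel_coeff \<beta> z j n =
    (\<Sum>k\<le>n. pochhammer (of_nat j) k / fact k * z ^ k * binom_coeff \<beta> k n)"
proof -
  have "hyp2F1 (of_nat j) (- of_nat n) \<beta> (- z) =
      (\<Sum>k\<le>n. pochhammer (of_nat j) k * pochhammer (- of_nat n) k / (pochhammer \<beta> k * fact k) * (- z) ^ k)"
    unfolding hyp2F1_def by (rule suminf_finite) (auto simp: pochhammer_of_nat_eq_0_iff)
  hence "kernel_coeff \<beta> z j n = (\<Sum>k\<le>n. pochhammer \<beta> n / fact n *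
      (pochhammer (of_nat j) k * pochhammer (- of_nat n) k / (pochhammer \<beta> k * fact k) * (- z) ^ k))"
    by (simp add: kernel_coeff_def sum_distrib_left)
  also have "\<dots> = (\<Sum>k\<le>n. pochhammer (of_nat j) k / fact k * z ^ k * binom_coeff \<beta> k n)"
  proof (rule sum.cong[OF refl])
    fix k assume "k \<in> {..n}"
    hence k: "k \<le> n" by simp
    have 1: "pochhammer \<beta> n = pochhammer \<beta> k * pochhammer (\<beta> + of_nat k) (n - k)"
      using k by (rule pochhammer_product)
    have "pochhammer (1 :: complex) n = pochhammer 1 (n - k) * pochhammer (1 + of_nat (n - k)) k"
      using pochhammer_product[of "n - k" n "1::complex"] k by simp
    hence "fact n = fact (n - k) * pochhammer (of_nat n - of_nat k + 1 :: complex) k"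
      using k by (simp add: pochhammer_fact[symmetric] of_nat_diff add_ac)
    hence 2: "pochhammer (- of_nat n :: complex) k * fact (n - k) = (- 1) ^ k * fact n"
      by (simp add: pochhammer_minus)
    have 3: "(- z) ^ k = (- 1) ^ k * z ^ k" by (rule power_minus)
    have 4: "(-1) ^ k * (-1) ^ k = (1 :: complex)" by (simp flip: power_mult_distrib)
    have "fact (n - k) * ((- 1) ^ k * pochhammer (- of_nat n :: complex) k) =
        (- 1) ^ k * (pochhammer (- of_nat n) k * fact (n - k))" by (simp only: mult_ac)
    hence "fact (n - k) * ((- 1) ^ k * pochhammer (- of_nat n :: complex) k) = fact n"
      unfolding 2 mult.assoc[symmetric] 4 by simp
    thus "pochhammer \<beta> n / fact n *
      (pochhammer (of_nat j) k * pochhammer (- of_nat n) k / (pochhammer \<beta> k * fact k) * (- z) ^ k)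
       = pochhammer (of_nat j) k / fact k * z ^ k * binom_coeff \<beta> k n"
      using pochhammer_not_nonpos_Ints[OF assms, of k] k
      unfolding 1 3 binom_coeff_def by (simp add: field_simps)
  qed
  finally show ?thesis .
qed

lemma kernel_coeff_recurrence:
  assumes "\<beta> \<notin> \<int>\<^sub>\<le>\<^sub>0"
  shows "kernel_coeff \<beta> z (Suc j) (Suc n) - (1 + z) * kernel_coeff \<beta> z (Suc j) n =
         kernel_coeff \<beta> z j (Suc n) - kernel_coeff \<beta> z j n"
proof -
  define q where "q j k = pochhammer (of_nat j) k / fact k * z ^ k" for j k
  have q0: "q j 0 = 1" for j by (simp add: q_def)
  have qS: "q (Suc j) (Suc i) - q j (Suc i) = z * q (Suc j) i" for i
  proof -
    have "pochhammer (of_nat j :: complex) (Suc i) = of_nat j * pochhammer (of_nat (Suc j)) i"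
      by (simp add: pochhammer_rec add_ac)
    moreover have "pochhammer (of_nat (Suc j) :: complex) (Suc i) =
        pochhammer (of_nat (Suc j)) i * (of_nat (Suc j) + of_nat i)"
      by (simp add: pochhammer_Suc)
    moreover have "(1 + of_nat i :: complex) \<noteq> 0"
      by (metis of_nat_Suc of_nat_neq_0)
    ultimately show ?thesis
      unfolding q_def by (simp add: fact_Suc divide_simps) (simp add: algebra_simps)
  qed
  have kc: "kernel_coeff \<beta> z j n = (\<Sum>k\<le>Suc n. q j k * binom_coeff \<beta> k n)"
    and kcS: "kernel_coeff \<beta> z j (Suc n) = (\<Sum>k\<le>Suc n. q j k * binom_coeff \<beta> k (Suc n))" for j
    by (simp_all add: kernel_coeff_altdef[OF assms] q_def binom_coeff_def mult_ac)
  have "(kernel_coeff \<beta> z (Suc j) (Suc n) - kernel_coeff \<beta> z (Suc j) n)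
      - (kernel_coeff \<beta> z j (Suc n) - kernel_coeff \<beta> z j n)
      = (\<Sum>k\<le>Suc n. (q (Suc j) k - q j k) * (binom_coeff \<beta> k (Suc n) - binom_coeff \<beta> k n))"
    unfolding kc kcS sum_subtractf[symmetric] by (intro sum.cong refl) (simp add: algebra_simps)
  also have "\<dots> = (\<Sum>k\<le>n. z * q (Suc j) k * binom_coeff \<beta> k n)"
    by (subst sum.atMost_Suc_shift) (simp add: q0 qS binom_coeff_Suc_Suc_diff)
  also have "\<dots> = z * kernel_coeff \<beta> z (Suc j) n"
    by (simp add: kernel_coeff_altdef[OF assms] q_def sum_distrib_left mult_ac)
  finally show ?thesis by (simp add: algebra_simps)
qed

lemma kernel_coeff_0_right: "kernel_coeff \<beta> z j 0 = 1"
proof -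
  have "hyp2F1 (of_nat j) 0 \<beta> (- z) =
      (\<Sum>k\<in>{0}. pochhammer (of_nat j) k * pochhammer 0 k / (pochhammer \<beta> k * fact k) * (- z) ^ k)"
    unfolding hyp2F1_def by (rule suminf_finite) (auto simp: pochhammer_0_left)
  thus ?thesis by (simp add: kernel_coeff_def)
qed

lemma kernel_coeff_0_left: "kernel_coeff \<beta> z 0 n = pochhammer \<beta> n / fact n"
proof -
  have "hyp2F1 0 (- of_nat n) \<beta> (- z) =
      (\<Sum>k\<in>{0}. pochhammer 0 k * pochhammer (- of_nat n) k / (pochhammer \<beta> k * fact k) * (- z) ^ k)"
    unfolding hyp2F1_def by (rule suminf_finite) (auto simp: pochhammer_0_left)
  thus ?thesis by (simp add: kernel_coeff_def)
qed

lemma kernel_has_fps_expansion: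
  assumes "\<beta> \<notin> \<int>\<^sub>\<le>\<^sub>0"
  shows "(\<lambda>t. (1 - t) powr (- \<beta>) * ((1 - t) / (1 - (1 + z) * t)) ^ j)
           has_fps_expansion Abs_fps (kernel_coeff \<beta> z j)"
proof (induction j)
  case 0
  have "eventually (\<lambda>t. t \<in> ball 0 1) (nhds (0::complex))"
    by (intro eventually_nhds_in_open) auto
  hence "eventually (\<lambda>t. (\<lambda>n. fps_nth (Abs_fps (kernel_coeff \<beta> z 0)) n * t ^ n) sums (1 - t) powr (- \<beta>)) (nhds 0)"
  proof eventually_elim
    case (elim t)
    have "(\<lambda>n. (- \<beta> gchoose n) * (- t) ^ n) sums (1 + (- t)) powr (- \<beta>)"
      using elim by (intro gen_binomial_complex) auto
    moreover have "(- \<beta> gchoose n) * (- t) ^ n = kernel_coeff \<beta> z 0 n * t ^ n" for n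
    proof -
      have "(- t) ^ n = (- 1) ^ n * t ^ n" by (rule power_minus)
      moreover have "(-1) ^ n * (-1) ^ n = (1 :: complex)" by (simp flip: power_mult_distrib)
      ultimately show ?thesis by (simp add: kernel_coeff_0_left gbinomial_pochhammer field_simps)
    qed
    ultimately show ?case by simp
  qed
  thus ?case by (auto intro: has_fps_expansionI)
next
  case (Suc j)
  define P where "P j = Abs_fps (kernel_coeff \<beta> z j)" for j
  define M where "M = 1 - fps_const (1 + z) * fps_X"
  have M0: "fps_nth M 0 \<noteq> 0" by (simp add: M_def)
  have "P (Suc j) * M = P j * (1 - fps_X)"
  proof (rule fps_ext)
    fix n
    have "fps_nth (P (Suc j) * M) n = fps_nth (P (Suc j) - fps_const (1 + z) * (fps_X * P (Suc j))) n"
      by (simp add: M_def algebra_simps)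
    also have "\<dots> = fps_nth (P j - fps_X * P j) n"
      using kernel_coeff_recurrence[OF assms, of z j "n - 1"]
      by (cases n) (simp_all add: P_def kernel_coeff_0_right)
    also have "P j - fps_X * P j = P j * (1 - fps_X)" by (simp add: algebra_simps)
    finally show "fps_nth (P (Suc j) * M) n = fps_nth (P j * (1 - fps_X)) n" .
  qed
  hence PS: "P (Suc j) = P j * (1 - fps_X) / M"
    using M0 by (metis fps_nonzeroI nonzero_mult_div_cancel_right fps_zero_nth)
  have "(\<lambda>t. (1 - t) powr (- \<beta>) * ((1 - t) / (1 - (1 + z) * t)) ^ j * (1 - t) / (1 - (1 + z) * t))
      has_fps_expansion P j * (1 - fps_X) / M"
    unfolding M_def
    by (intro has_fps_expansion_divide' has_fps_expansion_mult has_fps_expansion_diff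
          has_fps_expansion_const has_fps_expansion_1 has_fps_expansion_fps_X has_fps_expansion_cmult_left)
       (use Suc M0 in \<open>auto simp: P_def M_def\<close>)
  thus ?case by (simp add: PS[symmetric] P_def[symmetric] mult_ac)
qed

subsection \<open>The generating function of the inner sums\<close>

definition genfun :: "complex \<Rightarrow> complex \<Rightarrow> complex \<Rightarrow> complex \<Rightarrow> complex \<Rightarrow> complex \<Rightarrow> complex" where
  "genfun a b c \<beta> z t = (1 - t) powr (- \<beta>) * hyp1F2 a b c ((1 - t) / (1 - (1 + z) * t))"

lemma holomorphic_genfun:
  assumes "a \<notin> \<int>\<^sub>\<le>\<^sub>0" "b \<notin> \<int>\<^sub>\<le>\<^sub>0" "c \<notin> \<int>\<^sub>\<le>\<^sub>0"
    and "\<And>t. t \<in> A \<Longrightarrow> 1 - t \<notin> \<real>\<^sub>\<le>\<^sub>0" "\<And>t. t \<in> A \<Longrightarrow> (1 + z) * t \<noteq> 1"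
  shows "genfun a b c \<beta> z holomorphic_on A"
  unfolding genfun_def[abs_def] by (intro holomorphic_intros assms(1-3)) (use assms(4,5) in auto)

lemma kernel_coeff_sums_deriv_genfun:
  assumes abc: "a \<notin> \<int>\<^sub>\<le>\<^sub>0" "b \<notin> \<int>\<^sub>\<le>\<^sub>0" "c \<notin> \<int>\<^sub>\<le>\<^sub>0" and \<beta>: "\<beta> \<notin> \<int>\<^sub>\<le>\<^sub>0"
  shows "(\<lambda>j. coeff1F2 a b c j * kernel_coeff \<beta> z j n) sums ((deriv ^^ n) (genfun a b c \<beta> z) 0 / fact n)"
proof -
  define \<delta> where "\<delta> = 1 / (2 * (1 + norm (1 + z)))"
  have pos: "1 + norm (1 + z) > 0" by (simp add: add_pos_nonneg)
  have \<delta>: "\<delta> > 0" "\<delta> \<le> 1 / 2" "norm (1 + z) * \<delta> \<le> 1 / 2"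
    using pos by (auto simp: \<delta>_def field_simps)
  define D where "D = ball (0::complex) \<delta>"
  define w where "w t = (1 - t) / (1 - (1 + z) * t)" for t
  define K where "K j t = (1 - t) powr (- \<beta>) * w t ^ j" for j t
  have nz: "norm (1 - (1 + z) * t) \<ge> 1 / 2" "1 - t \<notin> \<real>\<^sub>\<le>\<^sub>0" "norm (1 - t) \<le> 2"
    if "t \<in> cball 0 \<delta>" for t
  proof -
    have t: "norm t \<le> \<delta>" using that by simp
    have "norm ((1 + z) * t) \<le> norm (1 + z) * \<delta>" using t by (simp add: norm_mult mult_left_mono)
    also note \<delta>(3)
    finally have "norm ((1 + z) * t) \<le> 1 / 2" .
    thus "norm (1 - (1 + z) * t) \<ge> 1 / 2"
      using norm_triangle_ineq2[of 1 "(1 + z) * t"] by simp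
    show "1 - t \<notin> \<real>\<^sub>\<le>\<^sub>0" using t \<delta>(2) by (intro one_minus_not_nonpos_Reals) auto
    show "norm (1 - t) \<le> 2" using norm_triangle_ineq4[of 1 t] t \<delta>(2) by simp
  qed
  have wb: "norm (w t) \<le> 4" if "t \<in> cball 0 \<delta>" for t
  proof -
    have "norm (w t) \<le> 2 / (1 / 2)"
      unfolding w_def norm_divide by (rule frac_le) (use nz[OF that] in auto)
    thus ?thesis by simp
  qed
  have "continuous_on (cball 0 \<delta>) (\<lambda>t. (1 - t) powr (- \<beta>))"
    by (intro holomorphic_on_imp_continuous_on holomorphic_intros nz(2))
  hence "bounded ((\<lambda>t. (1 - t) powr (- \<beta>)) ` cball 0 \<delta>)"
    by (intro compact_imp_bounded compact_continuous_image compact_cball)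
  then obtain M where M: "\<And>t. t \<in> cball 0 \<delta> \<Longrightarrow> norm ((1 - t) powr (- \<beta>)) \<le> M"
    unfolding bounded_iff by blast
  have "uniform_limit D (\<lambda>N t. \<Sum>j<N. coeff1F2 a b c j * K j t) (\<lambda>t. \<Sum>j. coeff1F2 a b c j * K j t) sequentially"
  proof (rule Weierstrass_m_test)
    show "summable (\<lambda>j. M * norm (coeff1F2 a b c j * 4 ^ j))"
      by (intro summable_mult hyp1F2_sums(2) abc)
    fix j t assume "t \<in> D"
    hence t: "t \<in> cball 0 \<delta>" by (simp add: D_def)
    have "norm (coeff1F2 a b c j * K j t) = norm (coeff1F2 a b c j) * (norm ((1 - t) powr (- \<beta>)) * norm (w t) ^ j)"
      by (simp add: K_def norm_mult norm_power)
    also have "\<dots> \<le> norm (coeff1F2 a b c j) * (M * 4 ^ j)"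
      by (intro mult_left_mono mult_mono power_mono M wb t order_trans[OF norm_ge_zero M[OF t]]) auto
    finally show "norm (coeff1F2 a b c j * K j t) \<le> M * norm (coeff1F2 a b c j * 4 ^ j)"
      by (simp add: norm_mult norm_power mult_ac)
  qed
  moreover have "(\<Sum>j. coeff1F2 a b c j * K j t) = genfun a b c \<beta> z t" for t
  proof -
    have "(\<lambda>j. (1 - t) powr (- \<beta>) * (coeff1F2 a b c j * w t ^ j)) sums ((1 - t) powr (- \<beta>) * hyp1F2 a b c (w t))"
      by (intro sums_mult hyp1F2_sums(1) abc)
    thus ?thesis by (simp add: sums_iff K_def genfun_def w_def mult_ac)
  qed
  ultimately have ul: "uniform_limit D (\<lambda>N t. \<Sum>j<N. coeff1F2 a b c j * K j t) (genfun a b c \<beta> z) sequentially"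
    by simp
  have "(\<lambda>N. (deriv ^^ n) (\<lambda>t. \<Sum>j<N. coeff1F2 a b c j * K j t) 0) \<longlonglongrightarrow> (deriv ^^ n) (genfun a b c \<beta> z) 0"
  proof (rule higher_deriv_complex_uniform_limit[OF ul])
    have "1 - (1 + z) * t \<noteq> 0" "1 - t \<notin> \<real>\<^sub>\<le>\<^sub>0" if "t \<in> D" for t
      using nz(1,2)[of t] that by (auto simp: D_def)
    thus "\<forall>\<^sub>F N in sequentially. (\<lambda>t. \<Sum>j<N. coeff1F2 a b c j * K j t) holomorphic_on D"
      unfolding K_def w_def by (intro always_eventually allI holomorphic_intros) auto
  qed (use \<delta> in \<open>auto simp: D_def\<close>)
  hence "(\<lambda>N. (deriv ^^ n) (\<lambda>t. \<Sum>j<N. coeff1F2 a b c j * K j t) 0 / fact n) \<longlonglongrightarrow> (deriv ^^ n) (genfun a b c \<beta> z) 0 / fact n"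
    by (intro tendsto_divide tendsto_const) auto
  moreover have "(deriv ^^ n) (\<lambda>t. \<Sum>j<N. coeff1F2 a b c j * K j t) 0 / fact n =
      (\<Sum>j<N. coeff1F2 a b c j * kernel_coeff \<beta> z j n)" for N
  proof -
    have "(\<lambda>t. \<Sum>j<N. coeff1F2 a b c j * K j t) has_fps_expansion
        (\<Sum>j<N. fps_const (coeff1F2 a b c j) * Abs_fps (kernel_coeff \<beta> z j))"
      unfolding K_def w_def
      by (intro has_fps_expansion_sum has_fps_expansion_cmult_left kernel_has_fps_expansion \<beta>)
    from fps_nth_fps_expansion[OF this, of n] show ?thesis by (simp add: fps_sum_nth)
  qed
  ultimately show ?thesis by (simp add: sums_def)
qed

subsection \<open>Singularities\<close>

lemma holomorphic_eq_on_connected: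
  assumes ev: "eventually (\<lambda>t. f t = g t) (nhds p)"
    and A: "open A" "connected A" "p \<in> A" "f holomorphic_on A" "g holomorphic_on A"
    and x: "x \<in> A"
  shows "f x = g x"
proof -
  obtain U where U: "open U" "p \<in> U" "\<And>t. t \<in> U \<Longrightarrow> f t = g t"
    using ev unfolding eventually_nhds by blast
  have "open (U \<inter> A)" "U \<inter> A \<noteq> {}" using U A by auto
  thus ?thesis
    using U A x by (intro analytic_continuation_open[of "U \<inter> A" A f g x]) auto
qed

text \<open>At $t_0 = 1/(1+z)$ the argument of the entire function ${}_1F_2$ has a pole, so an extension
  to $t_0$ would give ${}_1F_2$ a limit at infinity, against Liouville.\<close>

lemma genfun_no_extension_inside:
  assumes abc: "a \<notin> \<int>\<^sub>\<le>\<^sub>0" "b \<notin> \<int>\<^sub>\<le>\<^sub>0" "c \<notin> \<int>\<^sub>\<le>\<^sub>0"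
    and z: "norm (1 + z) > 1"
    and R: "R * norm (1 + z) > 1" and S: "S holomorphic_on ball 0 R"
    and ev: "eventually (\<lambda>t. S t = genfun a b c \<beta> z t) (nhds 0)"
  shows False
proof -
  define t0 where "t0 = 1 / (1 + z)"
  have z1: "1 + z \<noteq> 0" "z \<noteq> 0" using z by auto
  have t0: "norm t0 < 1" "norm t0 < R" "t0 \<noteq> 0"
    using z R z1 by (auto simp: t0_def norm_divide field_simps)
  have R0: "R > 0" using t0(2) norm_ge_zero[of t0] by linarith
  define B where "B = ball (0::complex) (min R 1)"
  define D where "D = B - {t0}"
  have B: "open B" "t0 \<in> B" "S holomorphic_on B" "\<And>t. t \<in> B \<Longrightarrow> 1 - t \<notin> \<real>\<^sub>\<le>\<^sub>0"
  proof -
    show "S holomorphic_on B" using S by (rule holomorphic_on_subset) (auto simp: B_def)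
    show "1 - t \<notin> \<real>\<^sub>\<le>\<^sub>0" if "t \<in> B" for t
      using that by (intro one_minus_not_nonpos_Reals) (auto simp: B_def)
  qed (use t0 in \<open>auto simp: B_def\<close>)
  have D: "open D" "connected D" "0 \<in> D" "D \<subseteq> B"
    using t0 R0 by (auto simp: D_def B_def intro!: connected_open_delete)
  have eq: "S t = genfun a b c \<beta> z t" if "t \<in> D" for t
  proof (rule holomorphic_eq_on_connected[OF ev D(1-3) _ _ that])
    show "S holomorphic_on D" using B(3) D(4) by (rule holomorphic_on_subset)
    have "(1 + z) * t \<noteq> 1" if "t \<in> D" for t
      using that z1 by (auto simp: D_def t0_def field_simps)
    thus "genfun a b c \<beta> z holomorphic_on D"
      using B(4) D(4) by (intro holomorphic_genfun abc) auto
  qed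
  define T where "T w = (w - 1) / ((1 + z) * w - 1)" for w
  have linf: "filterlim (\<lambda>w. (1 + z) * w - 1) at_infinity at_infinity"
  proof -
    have "filterlim (\<lambda>w. (1 + z) * w) at_infinity at_infinity"
      by (rule tendsto_mult_filterlim_at_infinity[OF tendsto_const z1(1)]) (rule filterlim_ident)
    from tendsto_add_filterlim_at_infinity[OF tendsto_const[of "-1"] this] show ?thesis by simp
  qed
  hence nz: "eventually (\<lambda>w. (1 + z) * w - 1 \<noteq> 0) at_infinity"
    by (rule filterlim_at_infinity_imp_eventually_ne)
  have Teq: "eventually (\<lambda>w. T w = t0 + (t0 - 1) / ((1 + z) * w - 1)) at_infinity"
    using nz
  proof eventually_elim
    case (elim w)
    thus ?case using z1 by (simp add: T_def t0_def divide_simps) (simp add: algebra_simps)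
  qed
  have "((\<lambda>w. t0 + (t0 - 1) / ((1 + z) * w - 1)) \<longlongrightarrow> t0 + 0) at_infinity"
    by (intro tendsto_add tendsto_const tendsto_divide_0[OF tendsto_const linf])
  hence T_lim: "(T \<longlongrightarrow> t0) at_infinity"
    by (subst tendsto_cong[OF Teq]) simp
  have S_lim: "((\<lambda>w. S (T w) * (1 - T w) powr \<beta>) \<longlongrightarrow> S t0 * (1 - t0) powr \<beta>) at_infinity"
  proof (intro tendsto_mult tendsto_powr_complex tendsto_diff tendsto_const T_lim)
    have "isCont S t0"
      using B by (intro continuous_on_interior[OF holomorphic_on_imp_continuous_on]) (auto simp: interior_open)
    thus "((\<lambda>w. S (T w)) \<longlongrightarrow> S t0) at_infinity" by (rule isCont_tendsto_compose[OF _ T_lim])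
  qed (use B in auto)
  have "eventually (\<lambda>w. T w \<in> B) at_infinity"
    using T_lim B(1,2) by (rule topological_tendstoD)
  hence "eventually (\<lambda>w. S (T w) * (1 - T w) powr \<beta> = hyp1F2 a b c w) at_infinity"
    using nz
  proof eventually_elim
    case (elim w)
    have t1: "1 - T w = z * w / ((1 + z) * w - 1)"
      using elim(2) by (simp add: T_def field_simps)
    have t2: "1 - (1 + z) * T w = z / ((1 + z) * w - 1)"
      using elim(2) by (simp add: T_def field_simps)
    have "T w \<noteq> t0"
      using t2 z1 elim(2) by (auto simp: t0_def)
    hence TD: "T w \<in> D" using elim by (auto simp: D_def)
    have "(1 - T w) / (1 - (1 + z) * T w) = w"
    proof -
      have "(z * w / d) / (z / d) = w" if "d \<noteq> 0" for d
        using that z1 by simp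
      thus ?thesis unfolding t1 t2 using elim(2) by blast
    qed
    moreover have "1 - T w \<noteq> 0" using B(4)[of "T w"] elim(1) by auto
    hence "(1 - T w) powr (- \<beta>) * (1 - T w) powr \<beta> = 1"
      by (simp add: powr_add[symmetric])
    ultimately show ?case
      unfolding eq[OF TD] genfun_def by (metis mult.commute mult.left_commute mult_1)
  qed
  with S_lim have "(hyp1F2 a b c \<longlongrightarrow> S t0 * (1 - t0) powr \<beta>) at_infinity"
    by (rule Lim_transform_eventually)
  thus False using hyp1F2_not_convergent_at_infinity[OF abc] by blast
qed

lemma genfun_no_extension_at_1:
  assumes abc: "a \<notin> \<int>\<^sub>\<le>\<^sub>0" "b \<notin> \<int>\<^sub>\<le>\<^sub>0" "c \<notin> \<int>\<^sub>\<le>\<^sub>0" and \<beta>: "\<beta> \<notin> \<int>\<^sub>\<le>\<^sub>0"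
    and z: "norm (1 + z) \<le> 1" "z \<noteq> 0 \<or> hyp1F2 a b c 1 \<noteq> 0"
    and R: "R > 1" and S: "S holomorphic_on ball 0 R"
    and ev: "eventually (\<lambda>t. S t = genfun a b c \<beta> z t) (nhds 0)"
  shows False
proof -
  define q where "q = (\<lambda>t. if z = 0 then hyp1F2 a b c 1 else hyp1F2 a b c ((1 - t) / (1 - (1 + z) * t)))"
  have q1: "q 1 \<noteq> 0" using z(2) hyp1F2_0[OF abc] by (auto simp: q_def)
  have in_ball: "(1 + z) * t \<noteq> 1" "1 - t \<notin> \<real>\<^sub>\<le>\<^sub>0" if "t \<in> ball 0 1" for t :: complex
  proof -
    have t: "norm t < 1" using that by simp
    have "norm ((1 + z) * t) \<le> norm t" using z(1) by (simp add: norm_mult mult_left_le_one_le)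
    thus "(1 + z) * t \<noteq> 1" using t by auto
    show "1 - t \<notin> \<real>\<^sub>\<le>\<^sub>0" using t by (intro one_minus_not_nonpos_Reals) auto
  qed
  have eq: "S t = (1 - t) powr (- \<beta>) * q t" if "t \<in> ball 0 1" for t :: complex
  proof -
    have "S t = genfun a b c \<beta> z t"
      using in_ball R S
      by (intro holomorphic_eq_on_connected[OF ev _ _ _ _ _ that] holomorphic_genfun abc)
         (auto elim!: holomorphic_on_subset)
    moreover have "t \<noteq> 1" using that by auto
    ultimately show ?thesis by (auto simp: genfun_def q_def)
  qed
  define V where "V = (if z = 0 then UNIV else {t. (1 + z) * t \<noteq> 1})"
  have V: "open V" "1 \<in> V"
    by (auto simp: V_def intro!: open_Collect_neq continuous_intros)
  have q: "q holomorphic_on V"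
  proof (cases "z = 0")
    case False
    thus ?thesis unfolding q_def V_def using abc by (auto intro!: holomorphic_intros)
  qed (auto simp: q_def)
  define W where "W = {t \<in> V. q t \<noteq> 0} \<inter> ball 0 R"
  have "{t \<in> V. q t \<noteq> 0} = V \<inter> q -` (- {0})" by auto
  moreover have "open (V \<inter> q -` (- {0}))"
    by (intro continuous_open_preimage holomorphic_on_imp_continuous_on q V) auto
  ultimately have "open W" by (auto simp: W_def)
  moreover have "1 \<in> W" using q1 R V by (auto simp: W_def)
  ultimately obtain d where d: "d > 0" "ball 1 d \<subseteq> W" by (rule openE)
  have "(\<lambda>t. S t / q t) holomorphic_on W"
    by (intro holomorphic_intros holomorphic_on_subset[OF S] holomorphic_on_subset[OF q]) (auto simp: W_def)
  hence "(\<lambda>t. S t / q t) holomorphic_on ball 1 d" using d(2) by (rule holomorphic_on_subset)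
  moreover have "S t / q t = (1 - t) powr (- \<beta>)" if "t \<in> ball 1 d" "norm t < 1" for t
    using eq[of t] that d(2) by (auto simp: W_def)
  ultimately have "\<beta> \<in> \<int>\<^sub>\<le>\<^sub>0" by (rule powr_extends_imp_nonpos_Ints[OF d(1)])
  with \<beta> show False by contradiction
qed

subsection \<open>The boundary case and the theorem\<close>

lemma genfun_sums_inside:
  assumes abc: "a \<notin> \<int>\<^sub>\<le>\<^sub>0" "b \<notin> \<int>\<^sub>\<le>\<^sub>0" "c \<notin> \<int>\<^sub>\<le>\<^sub>0"
    and u: "norm u < 1" "norm ((1 + z) * u) < 1"
  shows "(\<lambda>n. (deriv ^^ n) (genfun a b c \<beta> z) 0 / fact n * u ^ n) sums genfun a b c \<beta> z u"
proof -
  define r where "r = 1 / max 1 (norm (1 + z))"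
  have "norm t * max 1 (norm (1 + z)) = max (norm t) (norm ((1 + z) * t))" for t :: complex
    by (simp add: max_mult_distrib_left norm_mult mult.commute)
  hence r: "t \<in> ball 0 r \<longleftrightarrow> norm t < 1 \<and> norm ((1 + z) * t) < 1" for t :: complex
    by (simp add: r_def pos_less_divide_eq)
  have "genfun a b c \<beta> z holomorphic_on ball 0 r"
  proof (rule holomorphic_genfun[OF abc])
    fix t :: complex assume t: "t \<in> ball 0 r"
    show "1 - t \<notin> \<real>\<^sub>\<le>\<^sub>0" using t unfolding r by (intro one_minus_not_nonpos_Reals) auto
    show "(1 + z) * t \<noteq> 1" using t unfolding r by (metis norm_one less_irrefl)
  qed
  moreover have "u \<in> ball 0 r" using u r by blast
  ultimately show ?thesis using holomorphic_power_series[of "genfun a b c \<beta> z" 0 r u] by simp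
qed

text \<open>The second alternative covers the case \<^term>\<open>z = 0\<close>, \<^term>\<open>hyp1F2 a b c 1 = 0\<close>, in which
  everything vanishes and convergence does not restrict \<^term>\<open>u\<close>.\<close>

lemma genfun_series_sum:
  assumes abc: "a \<notin> \<int>\<^sub>\<le>\<^sub>0" "b \<notin> \<int>\<^sub>\<le>\<^sub>0" "c \<notin> \<int>\<^sub>\<le>\<^sub>0" and \<beta>: "\<beta> \<notin> \<int>\<^sub>\<le>\<^sub>0"
    and u: "u \<noteq> 1" "(1 + z) * u \<noteq> 1"
    and sm: "summable (\<lambda>n. (deriv ^^ n) (genfun a b c \<beta> z) 0 / fact n * u ^ n)"
  shows "(\<Sum>n. (deriv ^^ n) (genfun a b c \<beta> z) 0 / fact n * u ^ n) = genfun a b c \<beta> z u"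
    and "norm u \<le> 1 \<or> hyp1F2 a b c ((1 - u) / (1 - (1 + z) * u)) = 0"
proof -
  let ?g = "\<lambda>n. (deriv ^^ n) (genfun a b c \<beta> z) 0 / fact n"
  have "((\<Sum>n. ?g n * u ^ n) = genfun a b c \<beta> z u) \<and>
        (norm u \<le> 1 \<or> hyp1F2 a b c ((1 - u) / (1 - (1 + z) * u)) = 0)"
  proof (cases "z = 0 \<and> hyp1F2 a b c 1 = 0")
    case True
    have E0: "genfun a b c \<beta> z t = 0" if "t \<noteq> 1" for t
      using that True by (simp add: genfun_def)
    have "eventually (\<lambda>t. genfun a b c \<beta> z t = 0) (nhds 0)"
      using eventually_nhds_in_open[of "- {1::complex}" 0] by (rule eventually_mono) (auto intro: E0)
    hence "genfun a b c \<beta> z has_fps_expansion 0" by (simp add: has_fps_expansion_0_iff)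
    hence "?g n = 0" for n using fps_nth_fps_expansion by fastforce
    thus ?thesis using E0[OF u(1)] True u(1) by simp
  next
    case nontrivial: False
    define S where "S = eval_fps (Abs_fps ?g)"
    have "fps_conv_radius (Abs_fps ?g) \<ge> norm u"
      unfolding fps_conv_radius_def using sm by (intro conv_radius_geI) simp
    hence "ball 0 (norm u) \<subseteq> eball 0 (fps_conv_radius (Abs_fps ?g))"
      using eball_mono[of "ereal (norm u)"] by simp
    hence S: "S holomorphic_on ball 0 (norm u)"
      unfolding S_def by (rule holomorphic_on_eval_fps)
    have "eventually (\<lambda>t. t \<in> ball 0 1 \<inter> {t. norm ((1 + z) * t) < 1}) (nhds 0)"
      by (intro eventually_nhds_in_open open_Int open_Collect_less continuous_intros open_ball) auto
    hence ev: "eventually (\<lambda>t. S t = genfun a b c \<beta> z t) (nhds 0)"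
    proof eventually_elim
      case (elim t)
      thus ?case using genfun_sums_inside[OF abc, of t z \<beta>] by (simp add: S_def eval_fps_def sums_iff)
    qed
    have uz: "norm ((1 + z) * u) \<le> 1" and u1: "norm u \<le> 1"
    proof -
      have *: "norm u * norm (1 + z) \<le> 1" if "norm (1 + z) > 1"
        using genfun_no_extension_inside[OF abc that _ S ev] by force
      have **: "norm u \<le> 1" if "norm (1 + z) \<le> 1"
        using genfun_no_extension_at_1[OF abc \<beta> that _ _ S ev] nontrivial by force
      show "norm u \<le> 1"
      proof (cases "norm (1 + z) \<le> 1")
        case False
        hence "norm u * 1 \<le> norm u * norm (1 + z)" by (intro mult_left_mono) auto
        thus ?thesis using * False by simp
      qed (use ** in auto)
      thus "norm ((1 + z) * u) \<le> 1"
        using * by (cases "norm (1 + z) \<le> 1") (auto simp: norm_mult mult_le_one mult.commute)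
    qed
    have "((\<lambda>r. \<Sum>n. (?g n * u ^ n) * of_real r ^ n) \<longlongrightarrow> (\<Sum>n. ?g n * u ^ n)) (at_left (1::real))"
      by (rule Abel_limit[OF sm])
    moreover have "eventually (\<lambda>r. (\<Sum>n. (?g n * u ^ n) * of_real r ^ n) = genfun a b c \<beta> z (u * of_real r)) (at_left (1::real))"
      using eventually_at_left_real[of 0 "1::real", OF zero_less_one]
    proof eventually_elim
      case (elim r)
      have "norm v * r < 1" if "norm v \<le> 1" for v :: complex
      proof -
        have "norm v * r \<le> r" using elim that by (intro mult_left_le_one_le) auto
        also have "r < 1" using elim by simp
        finally show ?thesis .
      qed
      from this[OF u1] this[OF uz] show ?case
        using genfun_sums_inside[OF abc, of "u * of_real r" z \<beta>] elim
        by (simp add: sums_iff norm_mult power_mult_distrib mult_ac)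
    qed
    ultimately have "((\<lambda>r. genfun a b c \<beta> z (u * of_real r)) \<longlongrightarrow> (\<Sum>n. ?g n * u ^ n)) (at_left (1::real))"
      by (rule Lim_transform_eventually)
    moreover have "((\<lambda>r. genfun a b c \<beta> z (u * of_real r)) \<longlongrightarrow> genfun a b c \<beta> z u) (at_left (1::real))"
    proof -
      have lim: "((\<lambda>r. u * of_real r) \<longlongrightarrow> u) (at_left (1::real))"
        by (rule tendsto_eq_intros refl | simp)+
      have "isCont (hyp1F2 a b c) w" for w
        using holomorphic_on_imp_continuous_on[OF holomorphic_hyp1F2[OF abc, of UNIV]]
        by (simp add: continuous_on_eq_continuous_at)
      thus ?thesis unfolding genfun_def
        by (intro tendsto_mult tendsto_powr_complex isCont_tendsto_compose[where g = "hyp1F2 a b c"] tendsto_divide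
              tendsto_diff tendsto_const lim one_minus_not_nonpos_Reals u u1) (use u(2) in auto)
    qed
    ultimately show ?thesis using u1 tendsto_unique[OF trivial_limit_at_left_real] by blast
  qed
  thus "(\<Sum>n. ?g n * u ^ n) = genfun a b c \<beta> z u"
    and "norm u \<le> 1 \<or> hyp1F2 a b c ((1 - u) / (1 - (1 + z) * u)) = 0" by blast+
qed

theorem proposition3p42:
  fixes a b c x z \<alpha> :: complex and m :: nat
  assumes "m > 0"
    and "a \<notin> \<int>\<^sub>\<le>\<^sub>0" and "b \<notin> \<int>\<^sub>\<le>\<^sub>0" and "c \<notin> \<int>\<^sub>\<le>\<^sub>0"
    and "of_nat m + \<alpha> + 1 \<notin> \<int>\<^sub>\<le>\<^sub>0"
    and "x \<noteq> 1" and "x * z + 1 \<noteq> 0"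
  shows "let T = (\<lambda>n j :: nat.
           Gamma b * Gamma c * (- 1) ^ (2 * m + n) * (1 / (1 - x)) ^ n * x ^ n
             * Gamma (a + of_nat j) * Gamma (of_nat m + of_nat n + \<alpha> + 1)
             * hyp2F1 (of_nat j) (- of_nat n) (of_nat m + \<alpha> + 1) (- z)
           / (Gamma a * Gamma (of_nat j + 1) * Gamma (of_nat n + 1)
             * Gamma (b + of_nat j) * Gamma (c + of_nat j) * Gamma (of_nat m + \<alpha> + 1)))
         in (\<forall>n. summable (\<lambda>j. T n j))
          \<and> (norm x < norm (1 - x) \<and> norm (x * (1 + z)) < norm (1 - x)
               \<longrightarrow> summable (\<lambda>n. \<Sum>j. T n j))
          \<and> (summable (\<lambda>n. \<Sum>j. T n j) \<longrightarrow>
               (1 / (1 - x)) powi (- int m) * (1 - x) powr (\<alpha> + 1) * hyp1F2 a b c (1 / (x * z + 1))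
               = (\<Sum>n. \<Sum>j. T n j))"
proof -
  define \<beta> where "\<beta> = of_nat m + \<alpha> + 1"
  define u where "u = - x / (1 - x)"
  define g where "g n = (deriv ^^ n) (genfun a b c \<beta> z) 0 / fact n" for n
  define T where "T = (\<lambda>n j :: nat.
           Gamma b * Gamma c * (- 1) ^ (2 * m + n) * (1 / (1 - x)) ^ n * x ^ n
             * Gamma (a + of_nat j) * Gamma (of_nat m + of_nat n + \<alpha> + 1)
             * hyp2F1 (of_nat j) (- of_nat n) (of_nat m + \<alpha> + 1) (- z)
           / (Gamma a * Gamma (of_nat j + 1) * Gamma (of_nat n + 1)
             * Gamma (b + of_nat j) * Gamma (c + of_nat j) * Gamma (of_nat m + \<alpha> + 1)))"
  note abc = assms(2-4)
  have \<beta>: "\<beta> \<notin> \<int>\<^sub>\<le>\<^sub>0" using assms(5) by (simp add: \<beta>_def)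
  have x1: "1 - x \<noteq> 0" using assms(6) by simp
  have Gamma_shift: "Gamma (s + of_nat k) = pochhammer s k * Gamma s" "Gamma s \<noteq> 0"
    if "s \<notin> \<int>\<^sub>\<le>\<^sub>0" for s :: complex and k
    using pochhammer_Gamma[OF that, of k] that by (auto simp: Gamma_eq_zero_iff)
  have Gamma_of_nat: "Gamma (of_nat k + 1 :: complex) = fact k" for k
    using Gamma_fact[of k, where 'a = complex] by (simp add: add.commute)
  have T_eq: "T n j = coeff1F2 a b c j * kernel_coeff \<beta> z j n * u ^ n" for n j
  proof -
    have *: "of_nat m + of_nat n + \<alpha> + 1 = \<beta> + of_nat n" by (simp add: \<beta>_def)
    have "u ^ n = (- 1) ^ n * (1 / (1 - x)) ^ n * x ^ n"
      by (simp add: u_def flip: power_mult_distrib)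
    moreover have "(- 1) ^ (2 * m + n) = ((- 1) ^ n :: complex)"
      by (simp add: power_add)
    ultimately show ?thesis
      unfolding T_def * \<beta>_def[symmetric] coeff1F2_def kernel_coeff_def Gamma_of_nat
      using Gamma_shift(1)[OF abc(1), of j] Gamma_shift(1)[OF abc(2), of j] Gamma_shift(1)[OF abc(3), of j]
        Gamma_shift(1)[OF \<beta>, of n] Gamma_shift(2)[OF abc(1)] Gamma_shift(2)[OF abc(2)]
        Gamma_shift(2)[OF abc(3)] Gamma_shift(2)[OF \<beta>]
      by (simp add: mult_ac)
  qed
  have T_sums: "(\<lambda>j. T n j) sums (g n * u ^ n)" for n
    unfolding T_eq g_def by (intro sums_mult2 kernel_coeff_sums_deriv_genfun abc \<beta>)
  hence T_sum: "(\<Sum>j. T n j) = g n * u ^ n" for n by (simp add: sums_iff)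
  have one_minus_u: "1 - u = 1 / (1 - x)" using x1 by (simp add: u_def field_simps)
  have one_minus_zu: "1 - (1 + z) * u = (x * z + 1) / (1 - x)"
    using x1 by (simp add: u_def field_simps)
  have u: "u \<noteq> 1" "(1 + z) * u \<noteq> 1"
    using one_minus_u one_minus_zu x1 assms(7) by auto
  have arg: "(1 - u) / (1 - (1 + z) * u) = 1 / (x * z + 1)"
    unfolding one_minus_u one_minus_zu using x1 by simp
  have "summable (\<lambda>n. \<Sum>j. T n j)" if "norm x < norm (1 - x)" "norm (x * (1 + z)) < norm (1 - x)"
  proof -
    have "norm u < 1" "norm ((1 + z) * u) < 1"
      using that x1 by (simp_all add: u_def norm_divide norm_mult mult.commute)
    from genfun_sums_inside[OF abc this, of \<beta>] show ?thesis
      unfolding T_sum g_def by (simp add: sums_iff)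
  qed
  moreover have "(1 / (1 - x)) powi (- int m) * (1 - x) powr (\<alpha> + 1) * hyp1F2 a b c (1 / (x * z + 1))
      = (\<Sum>n. \<Sum>j. T n j)" if "summable (\<lambda>n. \<Sum>j. T n j)"
  proof -
    have sm: "summable (\<lambda>n. (deriv ^^ n) (genfun a b c \<beta> z) 0 / fact n * u ^ n)"
      using that unfolding T_sum g_def .
    have sum: "(\<Sum>n. \<Sum>j. T n j) = (1 - u) powr (- \<beta>) * hyp1F2 a b c (1 / (x * z + 1))"
      unfolding T_sum g_def using genfun_series_sum(1)[OF abc \<beta> u sm] by (simp add: genfun_def arg)
    show ?thesis
    proof (cases "hyp1F2 a b c (1 / (x * z + 1)) = 0")
      case False
      hence "norm u \<le> 1" using genfun_series_sum(2)[OF abc \<beta> u sm] by (simp add: arg)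
      hence "1 - u \<notin> \<real>\<^sub>\<le>\<^sub>0" using u(1) by (rule one_minus_not_nonpos_Reals)
      moreover have ux: "1 - x = inverse (1 - u)" by (simp add: one_minus_u)
      ultimately have "Ln (1 - x) = - Ln (1 - u)" by (simp add: Ln_inverse)
      hence "(1 - u) powr (- \<beta>) = (1 - x) powr \<beta>"
        using x1 u(1) by (simp add: powr_def)
      also have "\<dots> = (1 - x) ^ m * (1 - x) powr (\<alpha> + 1)"
        using x1 by (simp add: \<beta>_def powr_add powr_nat)
      also have "(1 - x) ^ m = (1 / (1 - x)) powi (- int m)"
        by (simp add: power_int_minus power_inverse divide_inverse)
      finally show ?thesis by (simp add: sum)
    qed (simp add: sum)
  qed
  ultimately show ?thesis
    using T_sums unfolding T_def[symmetric] Let_def by (auto simp: sums_iff)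
qed

end
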